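(* Let $K\in L^1(\Omega)\cap L^2(\Omega)\cap\mathcal{C}(\Omega)$ (real- or complex-valued), let $f\in\mathcal{C}(\Omega)$, and put $F=Kf$. Let $0<n'\le n$ be integers, and let the $m$-point quadrature rule with points $x_j\in\Omega$ and weights $w_j>0$, $j=1,\dots,m$, have exactness degree $n+n'$ and satisfy the Marcinkiewicz--Zygmund property with constant $\eta\in[0,1)$. Let $\mathcal{S}_nF$ be the efficient hyperinterpolant of degree $n$ of $F=Kf$. Then $$\|\mathcal{S}_nF\|_2\leq \frac{V^{1/2}}{\sqrt{1-\eta}}\,\|K\|_{\infty}\,\|f\|_{\infty}$$ and $$\|\mathcal{S}_nF-F\|_2\leq \left(\frac{V^{1/2}}{\sqrt{1-\eta}}\|K\|_{\infty}+\|K\|_2\right)E_{n'}(f)+2V^{1/2}E_n(K\chi^* ),$$ where $E_k(g)=\inf_{\chi\in\mathbb{P}_k}\|g-\chi\|_\infty$ for $g\in\mathcal{C}(\Omega)$, and $\chi^*\in\mathbb{P}_{n'}$ is the best uniform approximation of $f$ in $\mathbb{P}_{n'}$, i.e. $\|f-\chi^*\|_\infty=E_{n'}(f)$.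
   Context: $\Omega\subset\mathbb{R}^s$ is a bounded region, either the closure of a connected open domain or a smooth closed lower-dimensional manifold, with a given measure $\mathrm{d}\omega$ of finite total mass $V=\int_\Omega \mathrm{d}\omega<\infty$. $L^p(\Omega)$ ($1\le p<\infty$) is taken with respect to $\mathrm{d}\omega$ with norm $\|g\|_p=(\int_\Omega|g|^p\,\mathrm{d}\omega)^{1/p}$, and $\|g\|_\infty=\sup_{x\in\Omega}|g(x)|$. $\mathcal{C}(\Omega)$ is the space of continuous functions with norm $\|\cdot\|_\infty$. $\langle v,z\rangle=\int_\Omega v\bar z\,\mathrm{d}\omega$. Scalars are real if all given functions are real-valued, and complex otherwise. $\mathbb{P}_n$ is the linear space (over these scalars) of restrictions to $\Omega$ of polynomials of degree at most $n$, $d_n=\dim\mathbb{P}_n$, and $p_1,\dots,p_{d_n}$ is an orthonormal basis of $\mathbb{P}_n$ for $\langle\cdot,\cdot\rangle$ consisting of real-valued polynomials. Quadrature rule: points $x_j\in\Omega$, weights $w_j>0$ ($j=1,\dots,m$); write $\langle v,z\rangle_m=\sum_{j=1}^m w_jv(x_j)\overline{z(x_j)}$. Exactness degree $N$ means $\sum_{j=1}^m w_jg(x_j)=\int_\Omega g\,\mathrm{d}\omega$ for all $g\in\mathbb{P}_N$. The Marcinkiewicz--Zygmund property with constant $\eta\in[0,1)$ means $\left|\sum_{j=1}^m w_j\chi(x_j)^2-\int_\Omega\chi^2\,\mathrm{d}\omega\right|\le\eta\int_\Omega\chi^2\,\mathrm{d}\omega$ for all real-valued $\chi\in\mathbb{P}_n$,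 with $\eta=0$ if $n'=n$. Hyperinterpolant of a continuous $f$: $\mathcal{L}_nf=\sum_{\ell=1}^{d_n}\langle f,p_\ell\rangle_m\,p_\ell$. Efficient hyperinterpolant of $F=Kf$ (with respect to the given factorization into $K$ and $f$): $\mathcal{S}_nF=\sum_{\ell=1}^{d_n}\left(\int_\Omega K(\mathcal{L}_nf)p_\ell\,\mathrm{d}\omega\right)p_\ell$. *)

theory Defs
  imports "HOL-Analysis.Analysis"
begin

section \<open>Regions and measures\<close>

text \<open>\<open>k\<close>-fold continuous differentiability on an open set, by recursion on directional
  derivatives.\<close>

primrec Ck_on :: "nat \<Rightarrow> 'a::euclidean_space set \<Rightarrow> ('a \<Rightarrow> 'b::euclidean_space) \<Rightarrow> bool" where
  "Ck_on 0 U g \<longleftrightarrow> continuous_on U g"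
| "Ck_on (Suc k) U g \<longleftrightarrow>
     (\<exists>D. (\<forall>x\<in>U. (g has_derivative D x) (at x)) \<and> (\<forall>v. Ck_on k U (\<lambda>x. D x v)))"

definition smooth_on :: "'a::euclidean_space set \<Rightarrow> ('a \<Rightarrow> 'b::euclidean_space) \<Rightarrow> bool" where
  "smooth_on U g \<longleftrightarrow> (\<forall>k. Ck_on k U g)"

text \<open>A closed manifold is a compact one without boundary. It is embedded in the ambient space:
  near each of its points a smooth diffeomorphism of open sets flattens it to a coordinate subspace
  of dimension \<open>d\<close>.\<close>

definition smooth_closed_manifold :: "nat \<Rightarrow> (real ^ 's) set \<Rightarrow> bool" where
  "smooth_closed_manifold d S \<longleftrightarrow>
     compact S \<and>
     (\<forall>x\<in>S. \<exists>U W (\<phi> :: real ^ 's \<Rightarrow> real ^ 's) \<psi> I.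
        open U \<and> x \<in> U \<and> open W \<and> homeomorphism U W \<phi> \<psi> \<and> smooth_on U \<phi> \<and> smooth_on W \<psi> \<and>
        card I = d \<and> \<phi> ` (U \<inter> S) = W \<inter> {y. \<forall>i. i \<notin> I \<longrightarrow> y $ i = 0})"

definition bounded_region :: "(real ^ 's) set \<Rightarrow> bool" where
  "bounded_region \<Omega> \<longleftrightarrow>
     \<Omega> \<noteq> {} \<and> bounded \<Omega> \<and>
     ((\<exists>U. open U \<and> connected U \<and> \<Omega> = closure U) \<or>
      (\<exists>d < CARD('s). smooth_closed_manifold d \<Omega>))"

text \<open>Only an inclusion of \<open>\<sigma>\<close>-algebras is required, so that completed measures are
  covered as well as Borel measures.\<close>

definition finite_measure_on :: "(real ^ 's) set \<Rightarrow> (real ^ 's) measure \<Rightarrow> bool" where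
  "finite_measure_on \<Omega> M \<longleftrightarrow>
     space M = \<Omega> \<and> sets (restrict_space borel \<Omega>) \<subseteq> sets M \<and> finite_measure M"


section \<open>Norms\<close>

text \<open>Functions on \<open>\<Omega>\<close> are represented by total complex-valued functions whose values
  outside \<open>\<Omega>\<close> play no role.\<close>

definition Lp_space :: "real \<Rightarrow> 'a measure \<Rightarrow> ('a \<Rightarrow> complex) set" where
  "Lp_space p M = {g \<in> borel_measurable M. integrable M (\<lambda>x. cmod (g x) powr p)}"

definition Lp_norm :: "real \<Rightarrow> 'a measure \<Rightarrow> ('a \<Rightarrow> complex) \<Rightarrow> real" where
  "Lp_norm p M g = (\<integral>x. cmod (g x) powr p \<partial>M) powr (1 / p)"

definition sup_norm :: "'a set \<Rightarrow> ('a \<Rightarrow> complex) \<Rightarrow> real" where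
  "sup_norm \<Omega> g = (SUP x\<in>\<Omega>. cmod (g x))"

definition L2_inner :: "'a measure \<Rightarrow> ('a \<Rightarrow> complex) \<Rightarrow> ('a \<Rightarrow> complex) \<Rightarrow> complex" where
  "L2_inner M v z = (\<integral>x. v x * cnj (z x) \<partial>M)"


section \<open>Polynomials on a region\<close>

text \<open>The scalar field, as a subset of the complex numbers.\<close>

definition scalars :: "'a set \<Rightarrow> ('a \<Rightarrow> complex) \<Rightarrow> ('a \<Rightarrow> complex) \<Rightarrow> complex set" where
  "scalars \<Omega> K f = (if \<forall>x\<in>\<Omega>. K x \<in> \<real> \<and> f x \<in> \<real> then \<real> else UNIV)"

definition multi_indices :: "nat \<Rightarrow> ('s::finite \<Rightarrow> nat) set" where
  "multi_indices n = {\<alpha>. (\<Sum>i\<in>UNIV. \<alpha> i) \<le> n}"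

text \<open>Finiteness matters here because a sum over an infinite index set would be zero.\<close>

lemma finite_multi_indices: "finite (multi_indices n :: ('s::finite \<Rightarrow> nat) set)"
proof (rule finite_subset)
  show "multi_indices n \<subseteq> PiE (UNIV :: 's set) (\<lambda>_. {..n})"
  proof
    fix \<alpha> :: "'s \<Rightarrow> nat" assume "\<alpha> \<in> multi_indices n"
    then have "\<alpha> i \<le> n" for i
      using member_le_sum[of i UNIV \<alpha>] by (simp add: multi_indices_def)
    then show "\<alpha> \<in> PiE UNIV (\<lambda>_. {..n})" by (simp add: PiE_UNIV_domain)
  qed
  show "finite (PiE (UNIV :: 's set) (\<lambda>_. {..n}))"
    by (rule finite_PiE) auto
qed

text \<open>The coefficients of the polynomial are taken in \<open>\<F>\<close>. Since values outside
  \<open>\<Omega>\<close> play no role, any total function agreeing with the polynomial on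
  \<open>\<Omega>\<close> represents its restriction.\<close>

definition polys :: "(real ^ 's) set \<Rightarrow> complex set \<Rightarrow> nat \<Rightarrow> (real ^ 's \<Rightarrow> complex) set" where
  "polys \<Omega> \<F> n =
     {g. \<exists>c. (\<forall>\<alpha>. c \<alpha> \<in> \<F>) \<and>
        (\<forall>x\<in>\<Omega>. g x = (\<Sum>\<alpha>\<in>multi_indices n. c \<alpha> * (\<Prod>i\<in>UNIV. complex_of_real (x $ i) ^ \<alpha> i)))}"

text \<open>Orthonormality entails linear independence, so the spanning condition makes
  \<open>p 1, \<dots>, p d\<close> a basis and forces \<open>d\<close> to be the dimension of
  \<open>polys \<Omega> \<F> n\<close> over \<open>\<F>\<close>.\<close>

definition real_orthonormal_basis ::
  "(real ^ 's) set \<Rightarrow> (real ^ 's) measure \<Rightarrow> complex set \<Rightarrow> nat \<Rightarrow> nat \<Rightarrow> (nat \<Rightarrow> real ^ 's \<Rightarrow> real) \<Rightarrow> bool"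
where
  "real_orthonormal_basis \<Omega> M \<F> n d p \<longleftrightarrow>
     (\<forall>l\<in>{1..d}. (\<lambda>x. complex_of_real (p l x)) \<in> polys \<Omega> \<F> n) \<and>
     (\<forall>k\<in>{1..d}. \<forall>l\<in>{1..d}.
        L2_inner M (\<lambda>x. complex_of_real (p k x)) (\<lambda>x. complex_of_real (p l x)) = (if k = l then 1 else 0)) \<and>
     (\<forall>g\<in>polys \<Omega> \<F> n. \<exists>a. (\<forall>l. a l \<in> \<F>) \<and>
        (\<forall>x\<in>\<Omega>. g x = (\<Sum>l=1..d. a l * complex_of_real (p l x))))"

definition best_error :: "(real ^ 's) set \<Rightarrow> complex set \<Rightarrow> nat \<Rightarrow> (real ^ 's \<Rightarrow> complex) \<Rightarrow> real" where
  "best_error \<Omega> \<F> k g = (INF q\<in>polys \<Omega> \<F> k. sup_norm \<Omega> (\<lambda>x. g x - q x))"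

definition best_uniform_approximation ::
  "(real ^ 's) set \<Rightarrow> complex set \<Rightarrow> nat \<Rightarrow> (real ^ 's \<Rightarrow> complex) \<Rightarrow> (real ^ 's \<Rightarrow> complex) \<Rightarrow> bool"
where
  "best_uniform_approximation \<Omega> \<F> k g q \<longleftrightarrow>
     q \<in> polys \<Omega> \<F> k \<and> sup_norm \<Omega> (\<lambda>x. g x - q x) = best_error \<Omega> \<F> k g"


section \<open>Quadrature and hyperinterpolation\<close>

definition positive_quadrature :: "'a set \<Rightarrow> nat \<Rightarrow> (nat \<Rightarrow> 'a) \<Rightarrow> (nat \<Rightarrow> real) \<Rightarrow> bool" where
  "positive_quadrature \<Omega> m xs w \<longleftrightarrow> (\<forall>j\<in>{1..m}. xs j \<in> \<Omega> \<and> w j > 0)"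

definition discrete_inner ::
  "nat \<Rightarrow> (nat \<Rightarrow> 'a) \<Rightarrow> (nat \<Rightarrow> real) \<Rightarrow> ('a \<Rightarrow> complex) \<Rightarrow> ('a \<Rightarrow> complex) \<Rightarrow> complex" where
  "discrete_inner m xs w v z = (\<Sum>j=1..m. complex_of_real (w j) * v (xs j) * cnj (z (xs j)))"

definition exactness_degree ::
  "(real ^ 's) set \<Rightarrow> (real ^ 's) measure \<Rightarrow> complex set \<Rightarrow> nat \<Rightarrow> (nat \<Rightarrow> real ^ 's) \<Rightarrow> (nat \<Rightarrow> real) \<Rightarrow> nat \<Rightarrow> bool"
where
  "exactness_degree \<Omega> M \<F> m xs w N \<longleftrightarrow>
     (\<forall>g\<in>polys \<Omega> \<F> N. (\<Sum>j=1..m. complex_of_real (w j) * g (xs j)) = (\<integral>x. g x \<partial>M))"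

text \<open>The last conjunct is the convention \<open>\<eta> = 0\<close> for exactness degree \<open>2 n\<close>.\<close>

definition MZ_property ::
  "(real ^ 's) set \<Rightarrow> (real ^ 's) measure \<Rightarrow> complex set \<Rightarrow> nat \<Rightarrow> (nat \<Rightarrow> real ^ 's) \<Rightarrow> (nat \<Rightarrow> real) \<Rightarrow>
   nat \<Rightarrow> nat \<Rightarrow> real \<Rightarrow> bool"
where
  "MZ_property \<Omega> M \<F> m xs w n n' \<eta> \<longleftrightarrow>
     0 \<le> \<eta> \<and> \<eta> < 1 \<and>
     (\<forall>q :: real ^ 's \<Rightarrow> real. (\<lambda>x. complex_of_real (q x)) \<in> polys \<Omega> \<F> n \<longrightarrow>
        \<bar>(\<Sum>j=1..m. w j * (q (xs j))\<^sup>2) - (\<integral>x. (q x)\<^sup>2 \<partial>M)\<bar> \<le> \<eta> * (\<integral>x. (q x)\<^sup>2 \<partial>M)) \<and>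
     (n' = n \<longrightarrow> \<eta> = 0)"

text \<open>In both operators the degree \<open>n\<close> enters through the basis \<open>p 1, \<dots>, p d\<close>.\<close>

definition hyperinterpolant ::
  "nat \<Rightarrow> (nat \<Rightarrow> 'a) \<Rightarrow> (nat \<Rightarrow> real) \<Rightarrow> nat \<Rightarrow> (nat \<Rightarrow> 'a \<Rightarrow> real) \<Rightarrow> ('a \<Rightarrow> complex) \<Rightarrow> 'a \<Rightarrow> complex"
where
  "hyperinterpolant m xs w d p f = (\<lambda>x. \<Sum>l=1..d.
     discrete_inner m xs w f (\<lambda>y. complex_of_real (p l y)) * complex_of_real (p l x))"

definition efficient_hyperinterpolant ::
  "'a measure \<Rightarrow> nat \<Rightarrow> (nat \<Rightarrow> 'a) \<Rightarrow> (nat \<Rightarrow> real) \<Rightarrow> nat \<Rightarrow> (nat \<Rightarrow> 'a \<Rightarrow> real) \<Rightarrow>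
   ('a \<Rightarrow> complex) \<Rightarrow> ('a \<Rightarrow> complex) \<Rightarrow> 'a \<Rightarrow> complex"
where
  "efficient_hyperinterpolant M m xs w d p K f = (\<lambda>x. \<Sum>l=1..d.
     (\<integral>y. K y * hyperinterpolant m xs w d p f y * complex_of_real (p l y) \<partial>M) * complex_of_real (p l x))"

end

theory Submission
  imports Defs
begin

text \<open>Write \<open>h\<close> for the hyperinterpolant of \<open>f\<close>. Since the coefficients of \<open>h\<close> are
  \<open>\<langle>f, p l\<rangle>\<^sub>m\<close>, Parseval gives \<open>\<parallel>h\<parallel>\<^sup>2 = \<langle>f, h\<rangle>\<^sub>m\<close>, and the Cauchy--Schwarz inequality for the discrete
  product together with the Marcinkiewicz--Zygmund property yields
  \<open>\<parallel>h\<parallel> \<le> sqrt (V (1 + \<eta>)) \<parallel>f\<parallel>\<^sub>\<infinity>\<close>, where \<open>1 + \<eta> \<le> 1 / (1 - \<eta>)\<close>. Bessel's inequality for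
  \<open>K h\<close> then bounds the efficient hyperinterpolant. For the error, exactness of degree
  \<open>n + n'\<close> makes the hyperinterpolant reproduce \<open>q = \<chi>\<^sup>*\<close>, so that with \<open>P\<close> the
  orthogonal projection onto the polynomials of degree \<open>n\<close> and \<open>S g\<close> the efficient
  hyperinterpolant of \<open>K g\<close>, \<open>S f - K f = S (f - q) + (P (K q) - K q) - K (f - q)\<close>.
  The middle term is a best \<open>L\<^sup>2\<close> approximation error, hence at most
  \<open>sqrt V\<close> times the best uniform error.\<close>

section \<open>Square integrals of bounded functions\<close>

text \<open>Over a finite measure this class lies inside \<open>L^2\<close> and, unlike
  \<open>L^2\<close> in general, is closed under products, so integrability of the integrands below
  follows from closure rules. Continuous functions on a compact region belong to it.\<close>

definition bounded_measurable :: "'a measure \<Rightarrow> ('a \<Rightarrow> complex) set" where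
  "bounded_measurable M = {g \<in> borel_measurable M. \<exists>B. \<forall>x\<in>space M. cmod (g x) \<le> B}"

lemma bounded_measurableE:
  assumes "g \<in> bounded_measurable M"
  obtains B where "g \<in> borel_measurable M" "B \<ge> 0" "\<And>x. x \<in> space M \<Longrightarrow> cmod (g x) \<le> B"
proof -
  obtain B where "g \<in> borel_measurable M" "\<forall>x\<in>space M. cmod (g x) \<le> B"
    using assms by (auto simp: bounded_measurable_def)
  \<comment> \<open>\<open>max 0 B\<close> is used because \<open>B\<close> may be negative when
    \<open>space M\<close> is empty.\<close>
  then show thesis
    by (intro that[of "max 0 B"]) (auto simp: le_max_iff_disj)
qed

lemma bounded_measurableI:
  "g \<in> borel_measurable M \<Longrightarrow> (\<And>x. x \<in> space M \<Longrightarrow> cmod (g x) \<le> B) \<Longrightarrow> g \<in> bounded_measurable M"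
  by (auto simp: bounded_measurable_def)

lemma bounded_measurable_const: "(\<lambda>x. c) \<in> bounded_measurable M"
  by (rule bounded_measurableI[of _ _ "cmod c"]) auto

lemma bounded_measurable_add:
  assumes "g \<in> bounded_measurable M" "h \<in> bounded_measurable M"
  shows "(\<lambda>x. g x + h x) \<in> bounded_measurable M"
proof -
  obtain B C where [measurable]: "g \<in> borel_measurable M" "h \<in> borel_measurable M"
    and "\<And>x. x \<in> space M \<Longrightarrow> cmod (g x) \<le> B" "\<And>x. x \<in> space M \<Longrightarrow> cmod (h x) \<le> C"
    using assms by (metis bounded_measurableE)
  then show ?thesis
    by (intro bounded_measurableI[of _ _ "B + C"]) (auto intro: norm_triangle_mono)
qed

lemma bounded_measurable_mult:
  assumes "g \<in> bounded_measurable M" "h \<in> bounded_measurable M"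
  shows "(\<lambda>x. g x * h x) \<in> bounded_measurable M"
proof -
  obtain B C where [measurable]: "g \<in> borel_measurable M" "h \<in> borel_measurable M"
    and "B \<ge> 0" "\<And>x. x \<in> space M \<Longrightarrow> cmod (g x) \<le> B" "\<And>x. x \<in> space M \<Longrightarrow> cmod (h x) \<le> C"
    using assms by (metis bounded_measurableE)
  then show ?thesis
    by (intro bounded_measurableI[of _ _ "B * C"]) (auto simp: norm_mult intro!: mult_mono)
qed

lemma bounded_measurable_cnj:
  assumes "g \<in> bounded_measurable M"
  shows "(\<lambda>x. cnj (g x)) \<in> bounded_measurable M"
proof -
  obtain B where g: "g \<in> borel_measurable M" and "\<And>x. x \<in> space M \<Longrightarrow> cmod (g x) \<le> B"
    using assms by (metis bounded_measurableE)
  moreover have "(\<lambda>x. cnj (g x)) \<in> borel_measurable M"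
    by (rule borel_measurable_continuous_on[OF _ g]) (intro continuous_intros)
  ultimately show ?thesis
    by (intro bounded_measurableI[of _ _ B]) auto
qed

lemma bounded_measurable_diff:
  assumes "g \<in> bounded_measurable M" "h \<in> bounded_measurable M"
  shows "(\<lambda>x. g x - h x) \<in> bounded_measurable M"
  using bounded_measurable_add[OF assms(1)
      bounded_measurable_mult[OF bounded_measurable_const[of "-1"] assms(2)]] by simp

lemma bounded_measurable_sum:
  "(\<And>l. l \<in> A \<Longrightarrow> g l \<in> bounded_measurable M) \<Longrightarrow> (\<lambda>x. \<Sum>l\<in>A. g l x) \<in> bounded_measurable M"
  by (induction A rule: infinite_finite_induct)
    (auto intro: bounded_measurable_add bounded_measurable_const)

lemmas bounded_measurable_intros =
  bounded_measurable_const bounded_measurable_add bounded_measurable_diff bounded_measurable_mult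
  bounded_measurable_cnj bounded_measurable_sum

section \<open>The \<open>L^2\<close> norm and inner product\<close>

lemma Lp_norm_2_nonneg: "0 \<le> Lp_norm 2 M g"
  by (simp add: Lp_norm_def)

text \<open>Squaring undoes the root because the integral of a nonnegative function is nonnegative;
  its default value is \<open>0\<close> when the function is not integrable.\<close>

lemma Lp_norm_2_squared: "(Lp_norm 2 M g)\<^sup>2 = (\<integral>x. (cmod (g x))\<^sup>2 \<partial>M)"
  by (simp add: Lp_norm_def powr_half_sqrt)

lemma L2_inner_self: "L2_inner M g g = complex_of_real ((Lp_norm 2 M g)\<^sup>2)"
  unfolding L2_inner_def Lp_norm_2_squared complex_norm_square[symmetric]
  by (rule integral_complex_of_real)

lemma L2_inner_commute: "L2_inner M v u = cnj (L2_inner M u v)"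
  by (simp add: L2_inner_def mult.commute flip: Bochner_Integration.integral_cnj)

section \<open>Orthonormal systems and norm inequalities over a finite measure\<close>

context finite_measure
begin

lemma integrable_bounded_measurable: "g \<in> bounded_measurable M \<Longrightarrow> integrable M g"
  by (erule bounded_measurableE) (rule integrable_const_bound, auto intro: AE_I2)

lemma integrable_square_bounded_measurable:
  assumes "g \<in> bounded_measurable M"
  shows "integrable M (\<lambda>x. (cmod (g x))\<^sup>2)"
proof -
  have "integrable M (\<lambda>x. cmod (g x * g x))"
    by (intro integrable_norm integrable_bounded_measurable bounded_measurable_intros assms)
  then show ?thesis by (simp add: norm_mult power2_eq_square)
qed

lemma L2_inner_diff_left:
  assumes "u \<in> bounded_measurable M" "v \<in> bounded_measurable M" "z \<in> bounded_measurable M"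
  shows "L2_inner M (\<lambda>x. u x - v x) z = L2_inner M u z - L2_inner M v z"
  unfolding L2_inner_def left_diff_distrib
  by (intro Bochner_Integration.integral_diff integrable_bounded_measurable
      bounded_measurable_intros assms)

lemma L2_inner_diff_right:
  assumes "u \<in> bounded_measurable M" "v \<in> bounded_measurable M" "z \<in> bounded_measurable M"
  shows "L2_inner M z (\<lambda>x. u x - v x) = L2_inner M z u - L2_inner M z v"
  using L2_inner_diff_left[OF assms] by (metis L2_inner_commute complex_cnj_diff)

lemma L2_inner_sum_left:
  assumes "\<And>l. l \<in> A \<Longrightarrow> e l \<in> bounded_measurable M" "z \<in> bounded_measurable M"
  shows "L2_inner M (\<lambda>x. \<Sum>l\<in>A. c l * e l x) z = (\<Sum>l\<in>A. c l * L2_inner M (e l) z)"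
proof -
  have "L2_inner M (\<lambda>x. \<Sum>l\<in>A. c l * e l x) z = (\<integral>x. (\<Sum>l\<in>A. c l * (e l x * cnj (z x))) \<partial>M)"
    by (simp add: L2_inner_def sum_distrib_right mult.assoc)
  also have "\<dots> = (\<Sum>l\<in>A. \<integral>x. c l * (e l x * cnj (z x)) \<partial>M)"
    by (intro Bochner_Integration.integral_sum integrable_bounded_measurable
        bounded_measurable_intros assms)
  finally show ?thesis by (simp add: L2_inner_def)
qed

text \<open>Expanding the square of the norm and completing the square in the coefficients
  \<open>c l\<close>. Parseval, Bessel and best approximation are all special cases.\<close>

lemma L2_dist_orthonormal_combination:
  assumes "finite A" and e: "\<And>l. l \<in> A \<Longrightarrow> e l \<in> bounded_measurable M"
    and u: "u \<in> bounded_measurable M"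
    and on: "\<And>k l. k \<in> A \<Longrightarrow> l \<in> A \<Longrightarrow> L2_inner M (e k) (e l) = (if k = l then 1 else 0)"
  shows "(Lp_norm 2 M (\<lambda>x. u x - (\<Sum>l\<in>A. c l * e l x)))\<^sup>2 =
    (Lp_norm 2 M u)\<^sup>2 - (\<Sum>l\<in>A. (cmod (L2_inner M u (e l)))\<^sup>2)
    + (\<Sum>l\<in>A. (cmod (L2_inner M u (e l) - c l))\<^sup>2)"
proof -
  define s where "s = (\<lambda>x. \<Sum>l\<in>A. c l * e l x)"
  define b where "b l = L2_inner M u (e l)" for l
  have s: "s \<in> bounded_measurable M"
    unfolding s_def by (intro bounded_measurable_intros e)
  have left: "L2_inner M s z = (\<Sum>l\<in>A. c l * L2_inner M (e l) z)" if "z \<in> bounded_measurable M" for z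
    unfolding s_def by (intro L2_inner_sum_left e that)
  have su: "L2_inner M s u = (\<Sum>l\<in>A. c l * cnj (b l))"
    unfolding left[OF u] b_def by (subst L2_inner_commute) simp
  have us: "L2_inner M u s = (\<Sum>l\<in>A. cnj (c l) * b l)"
    by (subst L2_inner_commute) (simp add: su)
  \<comment> \<open>Orthonormality enters here: the Kronecker delta leaves a single term of the
    sum.\<close>
  have es: "L2_inner M (e k) s = cnj (c k)" if "k \<in> A" for k
  proof -
    have "L2_inner M s (e k) = (\<Sum>l\<in>A. if k = l then c l else 0)"
      unfolding left[OF e[OF that]] using that by (intro sum.cong) (auto simp: on)
    also have "\<dots> = c k" using that \<open>finite A\<close> by simp
    finally show ?thesis by (subst L2_inner_commute) simp
  qed
  have ss: "L2_inner M s s = (\<Sum>l\<in>A. c l * cnj (c l))"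
    unfolding left[OF s] by (simp add: es)
  have "complex_of_real ((Lp_norm 2 M (\<lambda>x. u x - s x))\<^sup>2) =
      L2_inner M u u - L2_inner M s u - (L2_inner M u s - L2_inner M s s)"
    unfolding L2_inner_self[symmetric]
    by (simp add: L2_inner_diff_left L2_inner_diff_right u s bounded_measurable_diff)
  also have "\<dots> = L2_inner M u u - (\<Sum>l\<in>A. b l * cnj (b l)) + (\<Sum>l\<in>A. (b l - c l) * cnj (b l - c l))"
    unfolding su us ss by (simp add: algebra_simps sum.distrib sum_subtractf)
  also have "\<dots> = complex_of_real ((Lp_norm 2 M u)\<^sup>2 - (\<Sum>l\<in>A. (cmod (b l))\<^sup>2)
      + (\<Sum>l\<in>A. (cmod (b l - c l))\<^sup>2))"
    unfolding L2_inner_self complex_norm_square[symmetric] by simp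
  finally show ?thesis
    unfolding of_real_eq_iff s_def b_def .
qed

text \<open>The distance identity at \<open>u = 0\<close>, where all the numbers
  \<open>L2_inner M u (e l)\<close> vanish.\<close>

lemma parseval:
  assumes "finite A" "\<And>l. l \<in> A \<Longrightarrow> e l \<in> bounded_measurable M"
    and "\<And>k l. k \<in> A \<Longrightarrow> l \<in> A \<Longrightarrow> L2_inner M (e k) (e l) = (if k = l then 1 else 0)"
  shows "(Lp_norm 2 M (\<lambda>x. \<Sum>l\<in>A. c l * e l x))\<^sup>2 = (\<Sum>l\<in>A. (cmod (c l))\<^sup>2)"
  using L2_dist_orthonormal_combination[OF assms(1,2) bounded_measurable_const[of 0] assms(3), of c]
  by (simp add: Lp_norm_2_squared L2_inner_def)

text \<open>If \<open>c l\<close> is the Fourier coefficient of \<open>u\<close>, the last sum of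
  the distance identity vanishes and what remains equals a square, hence is nonnegative.\<close>

lemma bessel:
  assumes "finite A" "\<And>l. l \<in> A \<Longrightarrow> e l \<in> bounded_measurable M" "u \<in> bounded_measurable M"
    and "\<And>k l. k \<in> A \<Longrightarrow> l \<in> A \<Longrightarrow> L2_inner M (e k) (e l) = (if k = l then 1 else 0)"
  shows "Lp_norm 2 M (\<lambda>x. \<Sum>l\<in>A. L2_inner M u (e l) * e l x) \<le> Lp_norm 2 M u"
proof (rule power2_le_imp_le)
  have "0 \<le> (Lp_norm 2 M u)\<^sup>2 - (\<Sum>l\<in>A. (cmod (L2_inner M u (e l)))\<^sup>2)"
    using L2_dist_orthonormal_combination[OF assms, of "\<lambda>l. L2_inner M u (e l)"]
    by (metis (no_types, lifting) add.right_neutral cancel_comm_monoid_add_class.diff_cancel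
        norm_zero sum.neutral zero_eq_power2 zero_le_power2)
  then show "(Lp_norm 2 M (\<lambda>x. \<Sum>l\<in>A. L2_inner M u (e l) * e l x))\<^sup>2 \<le> (Lp_norm 2 M u)\<^sup>2"
    by (subst parseval[OF assms(1,2,4)]) auto
qed (rule Lp_norm_2_nonneg)

text \<open>In the distance identity \<open>c\<close> occurs in the last sum alone, and that sum is
  \<open>0\<close> at the Fourier coefficients.\<close>

lemma orthogonal_projection_best:
  assumes "finite A" "\<And>l. l \<in> A \<Longrightarrow> e l \<in> bounded_measurable M" "u \<in> bounded_measurable M"
    and "\<And>k l. k \<in> A \<Longrightarrow> l \<in> A \<Longrightarrow> L2_inner M (e k) (e l) = (if k = l then 1 else 0)"
  shows "Lp_norm 2 M (\<lambda>x. u x - (\<Sum>l\<in>A. L2_inner M u (e l) * e l x))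
    \<le> Lp_norm 2 M (\<lambda>x. u x - (\<Sum>l\<in>A. c l * e l x))"
  by (rule power2_le_imp_le[OF _ Lp_norm_2_nonneg])
    (simp add: L2_dist_orthonormal_combination[OF assms] sum_nonneg)

text \<open>A pointwise Young inequality with weights \<open>b / a\<close> and \<open>a / b\<close>
  is integrated. If \<open>a\<close> and \<open>b\<close> bound the two norms, these weights make
  the right-hand side exactly \<open>(a + b)^2\<close>.\<close>

lemma Lp_norm_2_triangle:
  assumes u: "u \<in> bounded_measurable M" and v: "v \<in> bounded_measurable M"
  shows "Lp_norm 2 M (\<lambda>x. u x + v x) \<le> Lp_norm 2 M u + Lp_norm 2 M v"
proof (rule field_le_epsilon)
  fix \<epsilon> :: real assume "\<epsilon> > 0"
  \<comment> \<open>The summand \<open>\<epsilon> / 2\<close> keeps \<open>a\<close> and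
    \<open>b\<close> positive, so the quotients make sense even if a norm is
    \<open>0\<close>.\<close>
  define a where "a = Lp_norm 2 M u + \<epsilon> / 2"
  define b where "b = Lp_norm 2 M v + \<epsilon> / 2"
  have pos: "a > 0" "b > 0"
    using \<open>\<epsilon> > 0\<close> Lp_norm_2_nonneg[of M] by (auto simp: a_def b_def add_nonneg_pos)
  have young: "(cmod (y + z))\<^sup>2 \<le> (1 + b / a) * (cmod y)\<^sup>2 + (1 + a / b) * (cmod z)\<^sup>2" for y z
  proof -
    have "0 \<le> (b * cmod y - a * cmod z)\<^sup>2 / (a * b)" using pos by simp
    also have "\<dots> = b / a * (cmod y)\<^sup>2 + a / b * (cmod z)\<^sup>2 - 2 * cmod y * cmod z"
      using pos by (simp add: field_simps power2_eq_square)
    finally have "(cmod y + cmod z)\<^sup>2 \<le> (1 + b / a) * (cmod y)\<^sup>2 + (1 + a / b) * (cmod z)\<^sup>2"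
      by (simp add: algebra_simps power2_eq_square)
    moreover have "(cmod (y + z))\<^sup>2 \<le> (cmod y + cmod z)\<^sup>2"
      by (intro power_mono norm_triangle_ineq) auto
    ultimately show ?thesis by linarith
  qed
  note int = integrable_square_bounded_measurable
  have "(Lp_norm 2 M (\<lambda>x. u x + v x))\<^sup>2
      \<le> (\<integral>x. (1 + b / a) * (cmod (u x))\<^sup>2 + (1 + a / b) * (cmod (v x))\<^sup>2 \<partial>M)"
    unfolding Lp_norm_2_squared
    by (intro integral_mono int bounded_measurable_add u v Bochner_Integration.integrable_add
        integrable_mult_right young)
  also have "\<dots> = (1 + b / a) * (Lp_norm 2 M u)\<^sup>2 + (1 + a / b) * (Lp_norm 2 M v)\<^sup>2"
    using int[OF u] int[OF v] by (simp add: Lp_norm_2_squared)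
  also have "\<dots> \<le> (1 + b / a) * a\<^sup>2 + (1 + a / b) * b\<^sup>2"
    using pos \<open>\<epsilon> > 0\<close> Lp_norm_2_nonneg[of M]
    by (intro add_mono mult_left_mono power_mono) (auto simp: a_def b_def)
  also have "\<dots> = (a + b)\<^sup>2"
    using pos by (simp add: field_simps power2_eq_square)
  finally have "Lp_norm 2 M (\<lambda>x. u x + v x) \<le> a + b"
    by (rule power2_le_imp_le) (use pos in simp)
  then show "Lp_norm 2 M (\<lambda>x. u x + v x) \<le> Lp_norm 2 M u + Lp_norm 2 M v + \<epsilon>"
    by (simp add: a_def b_def)
qed

lemma Lp_norm_2_mult_le:
  assumes "u \<in> bounded_measurable M" "v \<in> bounded_measurable M"
    and "\<And>x. x \<in> space M \<Longrightarrow> cmod (u x) \<le> B" "0 \<le> B"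
  shows "Lp_norm 2 M (\<lambda>x. u x * v x) \<le> B * Lp_norm 2 M v"
proof (rule power2_le_imp_le)
  have "(Lp_norm 2 M (\<lambda>x. u x * v x))\<^sup>2 \<le> (\<integral>x. B\<^sup>2 * (cmod (v x))\<^sup>2 \<partial>M)"
    unfolding Lp_norm_2_squared
    using assms(3)
    by (intro integral_mono integrable_square_bounded_measurable bounded_measurable_mult
        assms(1,2) integrable_mult_right)
      (auto simp: norm_mult power_mult_distrib intro!: mult_right_mono power_mono)
  then show "(Lp_norm 2 M (\<lambda>x. u x * v x))\<^sup>2 \<le> (B * Lp_norm 2 M v)\<^sup>2"
    by (simp add: power_mult_distrib Lp_norm_2_squared)
qed (simp add: assms(4) Lp_norm_2_nonneg)

text \<open>The preceding bound with \<open>v = 1\<close>, whose norm is the root of the total mass.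
  It is the source of the factor \<open>sqrt V\<close> in front of the best error of degree
  \<open>n\<close>.\<close>

lemma Lp_norm_2_le_sup:
  assumes "u \<in> bounded_measurable M" "\<And>x. x \<in> space M \<Longrightarrow> cmod (u x) \<le> B" "0 \<le> B"
  shows "Lp_norm 2 M u \<le> sqrt (measure M (space M)) * B"
proof -
  have "Lp_norm 2 M (\<lambda>x. 1) = sqrt (measure M (space M))"
    by (simp add: Lp_norm_def powr_half_sqrt)
  then show ?thesis
    using Lp_norm_2_mult_le[OF assms(1) bounded_measurable_const[of 1] assms(2,3)]
    by (simp add: mult.commute)
qed

end

lemma Lp_norm_cong: "(\<And>x. x \<in> space M \<Longrightarrow> g x = h x) \<Longrightarrow> Lp_norm r M g = Lp_norm r M h"
  unfolding Lp_norm_def by (intro arg_cong2[where f = "(powr)"] Bochner_Integration.integral_cong) auto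

section \<open>Continuous functions on a bounded region\<close>

lemma compact_bounded_region: "bounded_region \<Omega> \<Longrightarrow> compact \<Omega>"
  by (auto simp: bounded_region_def smooth_closed_manifold_def compact_eq_bounded_closed)

lemma bounded_measurable_continuous:
  assumes "finite_measure_on \<Omega> M" "compact \<Omega>" "continuous_on \<Omega> g"
  shows "g \<in> bounded_measurable M"
proof -
  have sp: "space M = \<Omega>" and sub: "sets (restrict_space borel \<Omega>) \<subseteq> sets M"
    using assms(1) by (auto simp: finite_measure_on_def)
  have "g \<in> borel_measurable (restrict_space borel \<Omega>)"
    using assms(3) by (rule borel_measurable_continuous_on_restrict)
  \<comment> \<open>The underlying set is the same and the \<sigma>-algebra of \<open>M\<close> is
    at least as large, so measurability carries over.\<close>
  then have "g \<in> borel_measurable M"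
    using sp sub by (auto simp: measurable_def space_restrict_space)
  moreover have "bounded (g ` \<Omega>)"
    using assms(2,3) by (intro compact_imp_bounded compact_continuous_image)
  then obtain B where "\<forall>x\<in>\<Omega>. cmod (g x) \<le> B"
    by (auto simp: bounded_iff)
  ultimately show ?thesis
    using sp by (intro bounded_measurableI[of _ _ B]) auto
qed

text \<open>Compactness bounds the values, so that the supremum of reals is a genuine upper
  bound.\<close>

lemma cmod_le_sup_norm:
  assumes "compact \<Omega>" "continuous_on \<Omega> g" "x \<in> \<Omega>"
  shows "cmod (g x) \<le> sup_norm \<Omega> g"
  unfolding sup_norm_def
proof (rule cSUP_upper[OF assms(3)])
  have "bounded ((\<lambda>x. cmod (g x)) ` \<Omega>)"
    using assms(1,2) by (intro compact_imp_bounded compact_continuous_image continuous_intros)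
  then show "bdd_above ((\<lambda>x. cmod (g x)) ` \<Omega>)" by (rule bounded_imp_bdd_above)
qed

lemma sup_norm_nonneg:
  assumes "compact \<Omega>" "\<Omega> \<noteq> {}" "continuous_on \<Omega> g"
  shows "0 \<le> sup_norm \<Omega> g"
  using assms cmod_le_sup_norm by (metis all_not_in_conv norm_ge_zero order_trans)

section \<open>Polynomials\<close>

definition monomial :: "('s::finite \<Rightarrow> nat) \<Rightarrow> real ^ 's \<Rightarrow> complex" where
  "monomial \<alpha> x = (\<Prod>i\<in>UNIV. complex_of_real (x $ i) ^ \<alpha> i)"

lemma polys_iff:
  "g \<in> polys \<Omega> \<F> n \<longleftrightarrow>
    (\<exists>c. (\<forall>\<alpha>. c \<alpha> \<in> \<F>) \<and> (\<forall>x\<in>\<Omega>. g x = (\<Sum>\<alpha>\<in>multi_indices n. c \<alpha> * monomial \<alpha> x)))"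
  by (simp add: polys_def monomial_def)

lemma continuous_on_polys:
  assumes "g \<in> polys \<Omega> \<F> n"
  shows "continuous_on \<Omega> g"
proof -
  obtain c where "\<forall>x\<in>\<Omega>. g x = (\<Sum>\<alpha>\<in>multi_indices n. c \<alpha> * monomial \<alpha> x)"
    using assms by (auto simp: polys_iff)
  moreover have "continuous_on \<Omega> (\<lambda>x. \<Sum>\<alpha>\<in>multi_indices n. c \<alpha> * monomial \<alpha> x)"
    unfolding monomial_def by (intro continuous_intros)
  ultimately show ?thesis
    by (metis (no_types, lifting) continuous_on_cong)
qed

text \<open>Treats real and complex scalars at once: both contain the reals and are closed under
  sums and products.\<close>

locale scalar_ring =
  fixes \<F> :: "complex set"
  assumes Reals_sub: "\<real> \<subseteq> \<F>"
    and add_closed: "a \<in> \<F> \<Longrightarrow> b \<in> \<F> \<Longrightarrow> a + b \<in> \<F>"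
    and mult_closed: "a \<in> \<F> \<Longrightarrow> b \<in> \<F> \<Longrightarrow> a * b \<in> \<F>"
begin

lemma sum_closed: "(\<And>l. l \<in> A \<Longrightarrow> a l \<in> \<F>) \<Longrightarrow> sum a A \<in> \<F>"
  by (induction A rule: infinite_finite_induct) (use Reals_sub in \<open>auto intro: add_closed\<close>)

lemma zero_closed: "0 \<in> \<F>"
  using Reals_sub by auto

lemma polys_mono:
  fixes \<Omega> :: "(real ^ 's) set"
  assumes "g \<in> polys \<Omega> \<F> n" "n \<le> k"
  shows "g \<in> polys \<Omega> \<F> k"
proof -
  obtain c where c: "\<forall>\<alpha>. c \<alpha> \<in> \<F>" "\<forall>x\<in>\<Omega>. g x = (\<Sum>\<alpha>\<in>multi_indices n. c \<alpha> * monomial \<alpha> x)"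
    using assms by (auto simp: polys_iff)
  \<comment> \<open>The coefficients are padded with zeros in the degrees above
    \<open>n\<close>.\<close>
  define c' where "c' \<alpha> = (if \<alpha> \<in> multi_indices n then c \<alpha> else 0)" for \<alpha>
  have sub: "multi_indices n \<subseteq> (multi_indices k :: ('s \<Rightarrow> nat) set)"
    using assms(2) by (auto simp: multi_indices_def)
  have "(\<Sum>\<alpha>\<in>multi_indices n. c \<alpha> * monomial \<alpha> x) = (\<Sum>\<alpha>\<in>multi_indices k. c' \<alpha> * monomial \<alpha> x)" for x
    by (rule sum.mono_neutral_cong_left[OF finite_multi_indices sub]) (auto simp: c'_def)
  then show ?thesis
    unfolding polys_iff using c by (intro exI[of _ c']) (auto simp: c'_def zero_closed)
qed

lemma polys_const:
  fixes \<Omega> :: "(real ^ 's) set"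
  assumes "a \<in> \<F>"
  shows "(\<lambda>x. a) \<in> polys \<Omega> \<F> n"
proof -
  \<comment> \<open>In degree \<open>0\<close> the zero multi-index is the single one, and its
    monomial is \<open>1\<close>.\<close>
  have eq: "multi_indices 0 = {\<lambda>_::'s. 0}"
    by (auto simp: multi_indices_def)
  have "(\<lambda>x. a) \<in> polys \<Omega> \<F> 0"
    unfolding polys_iff eq using assms by (intro exI[of _ "\<lambda>_. a"]) (auto simp: monomial_def)
  then show ?thesis by (rule polys_mono) simp
qed

lemma polys_add:
  assumes "g \<in> polys \<Omega> \<F> n" "h \<in> polys \<Omega> \<F> n"
  shows "(\<lambda>x. g x + h x) \<in> polys \<Omega> \<F> n"
proof -
  obtain b c where "\<forall>\<alpha>. b \<alpha> \<in> \<F>" "\<forall>x\<in>\<Omega>. g x = (\<Sum>\<alpha>\<in>multi_indices n. b \<alpha> * monomial \<alpha> x)"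
    and "\<forall>\<alpha>. c \<alpha> \<in> \<F>" "\<forall>x\<in>\<Omega>. h x = (\<Sum>\<alpha>\<in>multi_indices n. c \<alpha> * monomial \<alpha> x)"
    using assms by (auto simp: polys_iff)
  then show ?thesis
    unfolding polys_iff
    by (intro exI[of _ "\<lambda>\<alpha>. b \<alpha> + c \<alpha>"]) (auto simp: add_closed distrib_right sum.distrib)
qed

text \<open>The Cauchy product: \<open>s\<close> adds exponents, and the coefficient
  \<open>e \<gamma>\<close> collects the pairs of multi-indices with sum
  \<open>\<gamma>\<close>.\<close>

lemma polys_mult:
  fixes \<Omega> :: "(real ^ 's) set"
  assumes "g \<in> polys \<Omega> \<F> n" "h \<in> polys \<Omega> \<F> k"
  shows "(\<lambda>x. g x * h x) \<in> polys \<Omega> \<F> (n + k)"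
proof -
  obtain b c where b: "\<forall>\<alpha>. b \<alpha> \<in> \<F>" "\<forall>x\<in>\<Omega>. g x = (\<Sum>\<alpha>\<in>multi_indices n. b \<alpha> * monomial \<alpha> x)"
    and c: "\<forall>\<alpha>. c \<alpha> \<in> \<F>" "\<forall>x\<in>\<Omega>. h x = (\<Sum>\<alpha>\<in>multi_indices k. c \<alpha> * monomial \<alpha> x)"
    using assms by (auto simp: polys_iff)
  define P :: "(('s \<Rightarrow> nat) \<times> ('s \<Rightarrow> nat)) set" where "P = multi_indices n \<times> multi_indices k"
  define s :: "('s \<Rightarrow> nat) \<times> ('s \<Rightarrow> nat) \<Rightarrow> 's \<Rightarrow> nat" where "s = (\<lambda>(\<alpha>, \<beta>) i. \<alpha> i + \<beta> i)"
  define e where "e \<gamma> = (\<Sum>(\<alpha>, \<beta>)\<in>{z\<in>P. s z = \<gamma>}. b \<alpha> * c \<beta>)" for \<gamma>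
  have "e \<gamma> \<in> \<F>" for \<gamma>
    unfolding e_def using b(1) c(1) by (auto intro!: sum_closed mult_closed split: prod.splits)
  moreover have "g x * h x = (\<Sum>\<gamma>\<in>multi_indices (n + k). e \<gamma> * monomial \<gamma> x)" if "x \<in> \<Omega>" for x
  proof -
    have mono: "monomial \<alpha> x * monomial \<beta> x = monomial (s (\<alpha>, \<beta>)) x" for \<alpha> \<beta>
      by (simp add: monomial_def s_def power_add prod.distrib)
    have "g x * h x = (\<Sum>(\<alpha>, \<beta>)\<in>P. (b \<alpha> * monomial \<alpha> x) * (c \<beta> * monomial \<beta> x))"
      using b(2) c(2) that by (simp add: sum_product sum.cartesian_product P_def)
    also have "\<dots> = (\<Sum>z\<in>P. (case z of (\<alpha>, \<beta>) \<Rightarrow> b \<alpha> * c \<beta>) * monomial (s z) x)"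
      by (intro sum.cong) (auto simp: mono[symmetric] mult_ac)
    \<comment> \<open>Total degrees add, so \<open>s\<close> maps \<open>P\<close> into
      \<open>multi_indices (n + k)\<close> and grouping by the value of \<open>s\<close> counts each
      pair once.\<close>
    also have "\<dots> = (\<Sum>\<gamma>\<in>multi_indices (n + k).
        \<Sum>z\<in>{z\<in>P. s z = \<gamma>}. (case z of (\<alpha>, \<beta>) \<Rightarrow> b \<alpha> * c \<beta>) * monomial (s z) x)"
      by (intro sum.group[symmetric])
        (auto simp: P_def s_def multi_indices_def sum.distrib finite_multi_indices[unfolded multi_indices_def]
          intro: add_mono)
    also have "\<dots> = (\<Sum>\<gamma>\<in>multi_indices (n + k). e \<gamma> * monomial \<gamma> x)"
      unfolding e_def sum_distrib_right by (intro sum.cong) auto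
    finally show ?thesis .
  qed
  ultimately show ?thesis
    unfolding polys_iff by blast
qed

lemma polys_scale:
  assumes "a \<in> \<F>" "g \<in> polys \<Omega> \<F> n"
  shows "(\<lambda>x. a * g x) \<in> polys \<Omega> \<F> n"
  using polys_mult[OF polys_const[OF assms(1), of \<Omega> 0] assms(2)] by simp

lemma polys_sum:
  "(\<And>l. l \<in> A \<Longrightarrow> g l \<in> polys \<Omega> \<F> n) \<Longrightarrow> (\<lambda>x. \<Sum>l\<in>A. g l x) \<in> polys \<Omega> \<F> n"
  by (induction A rule: infinite_finite_induct) (auto intro: polys_add polys_const zero_closed)

end

lemma scalar_ring_scalars: "scalar_ring (scalars \<Omega> K f)"
  by unfold_locales (auto simp: scalars_def)

lemma best_error_nonneg:
  assumes "compact \<Omega>" "\<Omega> \<noteq> {}" "continuous_on \<Omega> g" "polys \<Omega> \<F> k \<noteq> {}"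
  shows "0 \<le> best_error \<Omega> \<F> k g"
  unfolding best_error_def
  by (intro cINF_greatest assms sup_norm_nonneg continuous_on_diff continuous_on_polys)

section \<open>Hyperinterpolation\<close>

text \<open>The setting of the theorem, with the region entering through compactness and
  nonemptiness.\<close>

locale hyperinterpolation = finite_measure M + scalar_ring \<F>
  for \<Omega> :: "(real ^ 's) set" and M :: "(real ^ 's) measure" and \<F> :: "complex set"
    and n n' m d :: nat and xs :: "nat \<Rightarrow> real ^ 's" and w :: "nat \<Rightarrow> real"
    and p :: "nat \<Rightarrow> real ^ 's \<Rightarrow> real" and \<eta> :: real +
  assumes measure: "finite_measure_on \<Omega> M"
    and compact: "compact \<Omega>" and nonempty: "\<Omega> \<noteq> {}"
    and degree_le: "n' \<le> n"
    and basis: "real_orthonormal_basis \<Omega> M \<F> n d p"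
    and quadrature: "positive_quadrature \<Omega> m xs w"
    and exact: "exactness_degree \<Omega> M \<F> m xs w (n + n')"
    and MZ: "MZ_property \<Omega> M \<F> m xs w n n' \<eta>"
begin

abbreviation e :: "nat \<Rightarrow> real ^ 's \<Rightarrow> complex" where
  "e l \<equiv> \<lambda>x. complex_of_real (p l x)"

abbreviation L :: "(real ^ 's \<Rightarrow> complex) \<Rightarrow> real ^ 's \<Rightarrow> complex" where
  "L \<equiv> hyperinterpolant m xs w d p"

abbreviation projection :: "(real ^ 's \<Rightarrow> complex) \<Rightarrow> real ^ 's \<Rightarrow> complex" where
  "projection g \<equiv> \<lambda>x. \<Sum>l=1..d. L2_inner M g (e l) * e l x"

lemma space_eq: "space M = \<Omega>"
  using measure by (simp add: finite_measure_on_def)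

lemma basis_poly: "l \<in> {1..d} \<Longrightarrow> e l \<in> polys \<Omega> \<F> n"
  using basis by (auto simp: real_orthonormal_basis_def)

lemma orthonormal:
  "k \<in> {1..d} \<Longrightarrow> l \<in> {1..d} \<Longrightarrow> L2_inner M (e k) (e l) = (if k = l then 1 else 0)"
  using basis by (auto simp: real_orthonormal_basis_def)

lemma continuous_bounded_measurable: "continuous_on \<Omega> g \<Longrightarrow> g \<in> bounded_measurable M"
  using measure compact by (rule bounded_measurable_continuous)

lemma basis_continuous: "l \<in> {1..d} \<Longrightarrow> continuous_on \<Omega> (e l)"
  by (rule continuous_on_polys[OF basis_poly])

lemma basis_bounded_measurable: "l \<in> {1..d} \<Longrightarrow> e l \<in> bounded_measurable M"
  by (intro continuous_bounded_measurable basis_continuous)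

lemma hyperinterpolant_continuous: "continuous_on \<Omega> (L g)"
  unfolding hyperinterpolant_def by (intro continuous_intros basis_continuous)

section \<open>The quadrature rule and the norm of the hyperinterpolant\<close>

lemma node: "j \<in> {1..m} \<Longrightarrow> xs j \<in> \<Omega>" and weight_pos: "j \<in> {1..m} \<Longrightarrow> 0 < w j"
  using quadrature by (auto simp: positive_quadrature_def)

text \<open>Exactness applied to the constant \<open>1\<close>.\<close>

lemma sum_weights: "(\<Sum>j=1..m. w j) = measure M \<Omega>"
proof -
  have "(\<lambda>x. 1) \<in> polys \<Omega> \<F> (n + n')"
    using Reals_sub by (intro polys_const) auto
  then have "(\<Sum>j=1..m. complex_of_real (w j) * 1) = (\<integral>x. 1 \<partial>M)"
    using exact unfolding exactness_degree_def by (rule bspec[rotated])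
  then have "complex_of_real (\<Sum>j=1..m. w j) = complex_of_real (measure M \<Omega>)"
    by (simp add: space_eq scaleR_conv_of_real)
  then show ?thesis by (simp only: of_real_eq_iff)
qed

text \<open>The Marcinkiewicz--Zygmund property speaks of real polynomials. Since the basis is real,
  a complex combination splits into real polynomials \<open>u\<close> and \<open>v\<close> whose
  squares add up to the squared modulus.\<close>

lemma discrete_norm_le:
  "(\<Sum>j=1..m. w j * (cmod (\<Sum>l=1..d. a l * e l (xs j)))\<^sup>2)
    \<le> (1 + \<eta>) * (Lp_norm 2 M (\<lambda>x. \<Sum>l=1..d. a l * e l x))\<^sup>2"
proof -
  define u where "u x = (\<Sum>l=1..d. Re (a l) * p l x)" for x
  define v where "v x = (\<Sum>l=1..d. Im (a l) * p l x)" for x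
  have split: "(cmod (\<Sum>l=1..d. a l * e l x))\<^sup>2 = (u x)\<^sup>2 + (v x)\<^sup>2" for x
    by (simp add: cmod_power2 u_def v_def)
  have poly: "(\<lambda>x. complex_of_real (\<Sum>l=1..d. b l * p l x)) \<in> polys \<Omega> \<F> n" for b :: "nat \<Rightarrow> real"
    unfolding of_real_sum of_real_mult using Reals_sub
    by (intro polys_sum polys_scale basis_poly) auto
  \<comment> \<open>Integrability is recorded too, so that the integrals of the two squares can be
    added.\<close>
  have int: "integrable M (\<lambda>x. (g x)\<^sup>2)" and
    le: "(\<Sum>j=1..m. w j * (g (xs j))\<^sup>2) \<le> (1 + \<eta>) * (\<integral>x. (g x)\<^sup>2 \<partial>M)"
    if "(\<lambda>x. complex_of_real (g x)) \<in> polys \<Omega> \<F> n" for g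
  proof -
    show "integrable M (\<lambda>x. (g x)\<^sup>2)"
      using integrable_square_bounded_measurable[OF continuous_bounded_measurable[OF
            continuous_on_polys[OF that]]] by simp
    have "\<bar>(\<Sum>j=1..m. w j * (g (xs j))\<^sup>2) - (\<integral>x. (g x)\<^sup>2 \<partial>M)\<bar> \<le> \<eta> * (\<integral>x. (g x)\<^sup>2 \<partial>M)"
      using MZ that by (auto simp: MZ_property_def)
    \<comment> \<open>The upper half of the two-sided estimate gives the factor
      \<open>1 + \<eta>\<close>.\<close>
    then show "(\<Sum>j=1..m. w j * (g (xs j))\<^sup>2) \<le> (1 + \<eta>) * (\<integral>x. (g x)\<^sup>2 \<partial>M)"
      by (simp add: distrib_right abs_le_iff)
  qed
  have uv: "(\<lambda>x. complex_of_real (u x)) \<in> polys \<Omega> \<F> n" "(\<lambda>x. complex_of_real (v x)) \<in> polys \<Omega> \<F> n"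
    unfolding u_def v_def by (rule poly)+
  show ?thesis
    using le[OF uv(1)] le[OF uv(2)] int[OF uv(1)] int[OF uv(2)]
    unfolding Lp_norm_2_squared split by (simp add: distrib_left sum.distrib)
qed

lemma hyperinterpolant_norm_le:
  assumes "continuous_on \<Omega> f"
  shows "Lp_norm 2 M (L f) \<le> sqrt (measure M \<Omega>) / sqrt (1 - \<eta>) * sup_norm \<Omega> f"
proof -
  define N where "N = Lp_norm 2 M (L f)"
  define S where "S = sup_norm \<Omega> f"
  define a where "a l = discrete_inner m xs w f (e l)" for l
  define T where "T = (\<Sum>j=1..m. w j * cmod (L f (xs j)))"
  have Lf: "L f = (\<lambda>x. \<Sum>l=1..d. a l * e l x)"
    by (simp add: hyperinterpolant_def a_def)
  have S: "0 \<le> S"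
    unfolding S_def by (intro sup_norm_nonneg compact nonempty assms)
  have N: "0 \<le> N"
    unfolding N_def by (rule Lp_norm_2_nonneg)
  have \<eta>: "0 \<le> \<eta>" "\<eta> < 1"
    using MZ by (auto simp: MZ_property_def)
  have N2: "N\<^sup>2 = (\<Sum>l=1..d. (cmod (a l))\<^sup>2)"
    unfolding N_def Lf by (intro parseval basis_bounded_measurable orthonormal) auto
  have "complex_of_real (N\<^sup>2) = (\<Sum>l=1..d. a l * cnj (a l))"
    unfolding N2 by (simp add: complex_norm_square[symmetric])
  \<comment> \<open>The first factor \<open>a l\<close> is written out as a discrete product; after
    swapping the sums, the conjugated factors add up to \<open>cnj (L f (xs j))\<close>.\<close>
  also have "\<dots> = (\<Sum>l=1..d. \<Sum>j=1..m. complex_of_real (w j) * f (xs j) * cnj (a l * e l (xs j)))"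
    unfolding a_def discrete_inner_def by (simp add: sum_distrib_right mult_ac)
  also have "\<dots> = (\<Sum>j=1..m. complex_of_real (w j) * f (xs j) * cnj (L f (xs j)))"
    unfolding Lf by (subst sum.swap) (simp add: sum_distrib_left)
  finally have "N\<^sup>2 = cmod (\<Sum>j=1..m. complex_of_real (w j) * f (xs j) * cnj (L f (xs j)))"
    by (metis abs_of_nonneg norm_of_real zero_le_power2)
  also have "\<dots> \<le> (\<Sum>j=1..m. w j * S * cmod (L f (xs j)))"
    unfolding S_def
    by (rule sum_norm_le) (auto simp: norm_mult intro!: mult_mono mult_nonneg_nonneg
        cmod_le_sup_norm compact assms node less_imp_le[OF weight_pos] S[unfolded S_def])
  also have "\<dots> = S * T"
    unfolding T_def sum_distrib_left by (simp add: mult_ac)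
  finally have N2_le: "N\<^sup>2 \<le> S * T" .
  \<comment> \<open>Each weight is split as \<open>sqrt (w j) * sqrt (w j)\<close>, so that
    Cauchy--Schwarz produces the sum of the weights, which is the total mass.\<close>
  have "T\<^sup>2 = (\<Sum>j=1..m. sqrt (w j) * (sqrt (w j) * cmod (L f (xs j))))\<^sup>2"
    unfolding T_def
    by (intro arg_cong[where f = "\<lambda>x. x\<^sup>2"] sum.cong)
      (auto simp: mult.assoc[symmetric] less_imp_le[OF weight_pos])
  also have "\<dots> \<le> (\<Sum>j=1..m. (sqrt (w j))\<^sup>2) * (\<Sum>j=1..m. (sqrt (w j) * cmod (L f (xs j)))\<^sup>2)"
    by (rule Cauchy_Schwarz_ineq_sum)
  also have "\<dots> = measure M \<Omega> * (\<Sum>j=1..m. w j * (cmod (L f (xs j)))\<^sup>2)"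
    using less_imp_le[OF weight_pos] by (simp add: power_mult_distrib sum_weights[symmetric])
  also have "\<dots> \<le> measure M \<Omega> * ((1 + \<eta>) * N\<^sup>2)"
    unfolding N_def Lf by (intro mult_left_mono discrete_norm_le) auto
  finally have T: "T\<^sup>2 \<le> measure M \<Omega> * (1 + \<eta>) * N\<^sup>2" by (simp add: mult.assoc)
  have "N\<^sup>2 \<le> measure M \<Omega> * (1 + \<eta>) * S\<^sup>2"
  \<comment> \<open>Squaring \<open>N2_le\<close> and inserting \<open>T\<close> leaves a common
    factor \<open>N^2\<close>, which is cancelled for \<open>N\<close> nonzero.\<close>
  proof (cases "N = 0")
    case False
    have "N\<^sup>2 * N\<^sup>2 \<le> (S * T)\<^sup>2"
      using power_mono[OF N2_le, of 2] by (simp add: power2_eq_square)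
    also have "\<dots> \<le> S\<^sup>2 * (measure M \<Omega> * (1 + \<eta>) * N\<^sup>2)"
      unfolding power_mult_distrib by (intro mult_left_mono T) auto
    finally have "N\<^sup>2 * N\<^sup>2 \<le> (measure M \<Omega> * (1 + \<eta>) * S\<^sup>2) * N\<^sup>2"
      by (simp add: mult_ac)
    then show ?thesis by (rule mult_right_le_imp_le) (use False in simp)
  qed (use \<eta> in simp)
  \<comment> \<open>This is \<open>(1 + \<eta>) * (1 - \<eta>) \<le> 1\<close>.\<close>
  also have "\<dots> \<le> measure M \<Omega> * (1 / (1 - \<eta>)) * S\<^sup>2"
    using \<eta> by (intro mult_right_mono mult_left_mono) (auto simp: field_simps)
  also have "\<dots> = (sqrt (measure M \<Omega>) / sqrt (1 - \<eta>) * S)\<^sup>2"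
    using \<eta> by (simp add: power_mult_distrib power_divide)
  finally show ?thesis
    unfolding N_def[symmetric] S_def[symmetric]
    by (rule power2_le_imp_le) (use \<eta> S in simp)
qed

section \<open>Reproduction of polynomials\<close>

lemma L2_inner_cong: "(\<And>x. x \<in> \<Omega> \<Longrightarrow> u x = v x) \<Longrightarrow> L2_inner M u z = L2_inner M v z"
  unfolding L2_inner_def by (rule Bochner_Integration.integral_cong) (auto simp: space_eq)

text \<open>The basis property supplies some coefficients; testing against \<open>e k\<close>
  identifies them as the Fourier coefficients.\<close>

lemma poly_expansion:
  assumes "q \<in> polys \<Omega> \<F> n" "x \<in> \<Omega>"
  shows "q x = projection q x"
proof -
  obtain a where a: "\<And>y. y \<in> \<Omega> \<Longrightarrow> q y = (\<Sum>l=1..d. a l * e l y)"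
    using basis assms(1) unfolding real_orthonormal_basis_def by blast
  have "L2_inner M q (e k) = a k" if k: "k \<in> {1..d}" for k
  proof -
    have "L2_inner M q (e k) = L2_inner M (\<lambda>y. \<Sum>l=1..d. a l * e l y) (e k)"
      by (rule L2_inner_cong) (rule a)
    also have "\<dots> = (\<Sum>l=1..d. a l * L2_inner M (e l) (e k))"
      by (intro L2_inner_sum_left basis_bounded_measurable k)
    also have "\<dots> = (\<Sum>l=1..d. if l = k then a l else 0)"
      by (intro sum.cong refl) (simp add: orthonormal[OF _ k])
    finally show ?thesis using k by simp
  qed
  then show ?thesis using a[OF assms(2)] by simp
qed

text \<open>The product of \<open>e l\<close> and \<open>q\<close> has degree at most
  \<open>n + n'\<close>, and \<open>e l\<close> is its own conjugate, so exactness turns the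
  discrete coefficients into the Fourier coefficients.\<close>

lemma hyperinterpolant_reproduces:
  assumes "q \<in> polys \<Omega> \<F> n'" "x \<in> \<Omega>"
  shows "L q x = q x"
proof -
  have "discrete_inner m xs w q (e l) = L2_inner M q (e l)" if "l \<in> {1..d}" for l
  proof -
    have "(\<lambda>x. e l x * q x) \<in> polys \<Omega> \<F> (n + n')"
      by (intro polys_mult basis_poly that assms(1))
    then have "(\<Sum>j=1..m. complex_of_real (w j) * (e l (xs j) * q (xs j))) = (\<integral>x. e l x * q x \<partial>M)"
      using exact unfolding exactness_degree_def by (rule bspec[rotated])
    then show ?thesis
      by (simp add: discrete_inner_def L2_inner_def mult_ac)
  qed
  then have "L q x = projection q x"
    by (simp add: hyperinterpolant_def)
  then show ?thesis
    using poly_expansion[OF polys_mono[OF assms(1) degree_le] assms(2)] by simp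
qed

section \<open>Stability and error of the efficient hyperinterpolant\<close>

lemma efficient_hyperinterpolant_eq:
  "efficient_hyperinterpolant M m xs w d p K f = projection (\<lambda>x. K x * L f x)"
  \<comment> \<open>The basis is real, so the conjugate in the inner product disappears.\<close>
  by (simp add: efficient_hyperinterpolant_def L2_inner_def)

lemma efficient_hyperinterpolant_norm_le:
  assumes "continuous_on \<Omega> K" "continuous_on \<Omega> f"
  shows "Lp_norm 2 M (efficient_hyperinterpolant M m xs w d p K f)
    \<le> sqrt (measure M \<Omega>) / sqrt (1 - \<eta>) * sup_norm \<Omega> K * sup_norm \<Omega> f"
proof -
  have "Lp_norm 2 M (efficient_hyperinterpolant M m xs w d p K f) \<le> Lp_norm 2 M (\<lambda>x. K x * L f x)"
    unfolding efficient_hyperinterpolant_eq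
    by (intro bessel basis_bounded_measurable orthonormal continuous_bounded_measurable
        continuous_on_mult assms hyperinterpolant_continuous) auto
  also have "\<dots> \<le> sup_norm \<Omega> K * Lp_norm 2 M (L f)"
    by (intro Lp_norm_2_mult_le continuous_bounded_measurable assms hyperinterpolant_continuous
        cmod_le_sup_norm sup_norm_nonneg compact nonempty) (simp add: space_eq)
  also have "\<dots> \<le> sup_norm \<Omega> K * (sqrt (measure M \<Omega>) / sqrt (1 - \<eta>) * sup_norm \<Omega> f)"
    by (intro mult_left_mono hyperinterpolant_norm_le sup_norm_nonneg compact nonempty assms)
  finally show ?thesis by (simp add: mult_ac)
qed

lemma projection_error_le:
  assumes "continuous_on \<Omega> g"
  shows "Lp_norm 2 M (\<lambda>x. projection g x - g x) \<le> sqrt (measure M \<Omega>) * best_error \<Omega> \<F> n g"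
proof -
  let ?E = "Lp_norm 2 M (\<lambda>x. projection g x - g x)"
  have each: "?E \<le> sqrt (measure M \<Omega>) * sup_norm \<Omega> (\<lambda>x. g x - q x)" if q: "q \<in> polys \<Omega> \<F> n" for q
  proof -
    have cont: "continuous_on \<Omega> (\<lambda>x. g x - q x)"
      by (intro continuous_on_diff assms continuous_on_polys[OF q])
    have "?E = Lp_norm 2 M (\<lambda>x. g x - projection g x)"
      unfolding Lp_norm_def by (simp only: norm_minus_commute)
    \<comment> \<open>The competitor is \<open>q\<close> itself, written as a combination of the
      basis.\<close>
    also have "\<dots> \<le> Lp_norm 2 M (\<lambda>x. g x - projection q x)"
      by (intro orthogonal_projection_best basis_bounded_measurable orthonormal
          continuous_bounded_measurable assms) auto
    also have "\<dots> = Lp_norm 2 M (\<lambda>x. g x - q x)"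
      using poly_expansion[OF q] by (intro Lp_norm_cong) (simp add: space_eq)
    also have "\<dots> \<le> sqrt (measure M \<Omega>) * sup_norm \<Omega> (\<lambda>x. g x - q x)"
      using Lp_norm_2_le_sup[OF continuous_bounded_measurable[OF cont]
          cmod_le_sup_norm[OF compact cont] sup_norm_nonneg[OF compact nonempty cont]]
      by (simp add: space_eq)
    finally show ?thesis .
  qed
  have zero: "(\<lambda>x. 0) \<in> polys \<Omega> \<F> n"
    by (intro polys_const zero_closed)
  show ?thesis
  \<comment> \<open>Passing to the infimum over \<open>q\<close> divides by
    \<open>sqrt (measure M \<Omega>)\<close>. For total mass \<open>0\<close> the estimate with
    \<open>q = 0\<close> already gives the bound \<open>0\<close>.\<close>
  proof (cases "measure M \<Omega> = 0")
    case True
    then show ?thesis using each[OF zero] by simp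
  next
    case False
    then have pos: "0 < sqrt (measure M \<Omega>)"
      by (simp add: zero_less_measure_iff)
    have "?E / sqrt (measure M \<Omega>) \<le> best_error \<Omega> \<F> n g"
      unfolding best_error_def
      using zero each pos by (intro cINF_greatest) (auto simp: field_simps)
    then show ?thesis using pos by (simp add: field_simps)
  qed
qed

text \<open>The operator is linear in \<open>f\<close>, and on the polynomial \<open>q\<close>,
  which \<open>L\<close> reproduces, it is the projection of \<open>K q\<close>. Both sides are
  compared through coefficients, that is, integrals over the region, so \<open>x\<close> may be any
  point.\<close>

lemma efficient_hyperinterpolant_decomposition:
  assumes K: "continuous_on \<Omega> K" and q: "q \<in> polys \<Omega> \<F> n'"
  shows "efficient_hyperinterpolant M m xs w d p K f x =
    efficient_hyperinterpolant M m xs w d p K (\<lambda>y. f y - q y) x + projection (\<lambda>y. K y * q y) x"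
proof -
  have lin: "L (\<lambda>y. f y - q y) y = L f y - L q y" for y
    by (simp add: hyperinterpolant_def discrete_inner_def left_diff_distrib right_diff_distrib sum_subtractf)
  have "L2_inner M (\<lambda>y. K y * L (\<lambda>y. f y - q y) y) (e l) =
      L2_inner M (\<lambda>y. K y * L f y) (e l) - L2_inner M (\<lambda>y. K y * q y) (e l)" if "l \<in> {1..d}" for l
  proof -
    have "L2_inner M (\<lambda>y. K y * L (\<lambda>y. f y - q y) y) (e l)
        = L2_inner M (\<lambda>y. K y * L f y - K y * q y) (e l)"
      by (rule L2_inner_cong) (simp add: lin hyperinterpolant_reproduces[OF q] right_diff_distrib)
    then show ?thesis
      using that
      by (simp add: L2_inner_diff_left continuous_bounded_measurable continuous_on_mult K
          hyperinterpolant_continuous basis_bounded_measurable continuous_on_polys[OF q])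
  qed
  then show ?thesis
    unfolding efficient_hyperinterpolant_eq
    by (simp add: sum.distrib[symmetric] left_diff_distrib)
qed

text \<open>Proved for every \<open>q\<close> of degree \<open>n'\<close>; the three summands
  \<open>A\<close>, \<open>B\<close>, \<open>C\<close> are bounded by stability, by the size of the
  residual and by the projection error.\<close>

lemma efficient_hyperinterpolant_error_le:
  assumes K: "continuous_on \<Omega> K" and f: "continuous_on \<Omega> f" and q: "q \<in> polys \<Omega> \<F> n'"
  shows "Lp_norm 2 M (\<lambda>x. efficient_hyperinterpolant M m xs w d p K f x - K x * f x)
    \<le> (sqrt (measure M \<Omega>) / sqrt (1 - \<eta>) * sup_norm \<Omega> K + Lp_norm 2 M K)
        * sup_norm \<Omega> (\<lambda>x. f x - q x)
      + sqrt (measure M \<Omega>) * best_error \<Omega> \<F> n (\<lambda>x. K x * q x)"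
proof -
  define r where "r = (\<lambda>x. f x - q x)"
  define A where "A = efficient_hyperinterpolant M m xs w d p K r"
  \<comment> \<open>The residual is the first factor so that its sup norm is pulled out, leaving the
    \<open>L^2\<close> norm of \<open>K\<close>.\<close>
  define B where "B = (\<lambda>x. - r x * K x)"
  define C where "C = (\<lambda>x. projection (\<lambda>y. K y * q y) x - K x * q x)"
  have cont: "continuous_on \<Omega> q" "continuous_on \<Omega> r"
    unfolding r_def using f q by (auto intro: continuous_on_diff continuous_on_polys)
  have bm: "A \<in> bounded_measurable M" "B \<in> bounded_measurable M" "C \<in> bounded_measurable M"
    unfolding A_def B_def C_def efficient_hyperinterpolant_eq
    by (intro bounded_measurable_intros continuous_bounded_measurable continuous_intros
        basis_continuous K cont; assumption)+
  have "Lp_norm 2 M (\<lambda>x. efficient_hyperinterpolant M m xs w d p K f x - K x * f x)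
      = Lp_norm 2 M (\<lambda>x. (A x + B x) + C x)"
    by (intro Lp_norm_cong)
      (simp add: efficient_hyperinterpolant_decomposition[OF K q, of f]
          A_def B_def C_def r_def algebra_simps)
  also have "\<dots> \<le> Lp_norm 2 M A + Lp_norm 2 M B + Lp_norm 2 M C"
    using Lp_norm_2_triangle[OF bounded_measurable_add[OF bm(1,2)] bm(3)]
      Lp_norm_2_triangle[OF bm(1,2)] by linarith
  also have "Lp_norm 2 M A \<le> sqrt (measure M \<Omega>) / sqrt (1 - \<eta>) * sup_norm \<Omega> K * sup_norm \<Omega> r"
    unfolding A_def by (intro efficient_hyperinterpolant_norm_le K cont)
  also have "Lp_norm 2 M B \<le> sup_norm \<Omega> r * Lp_norm 2 M K"
    unfolding B_def
    by (rule Lp_norm_2_mult_le)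
      (auto simp: space_eq intro!: continuous_bounded_measurable continuous_on_minus cont K
        cmod_le_sup_norm[OF compact cont(2)] sup_norm_nonneg compact nonempty)
  also have "Lp_norm 2 M C \<le> sqrt (measure M \<Omega>) * best_error \<Omega> \<F> n (\<lambda>x. K x * q x)"
    unfolding C_def by (intro projection_error_le continuous_on_mult K cont)
  finally show ?thesis
    unfolding r_def by (simp add: algebra_simps)
qed

end

section \<open>Bounded regions and the best uniform approximation\<close>

theorem theorem5p2:
  fixes \<Omega> :: "(real ^ 's) set" and M :: "(real ^ 's) measure"
    and K f F :: "real ^ 's \<Rightarrow> complex" and \<F> :: "complex set"
    and n n' m d :: nat and xs :: "nat \<Rightarrow> real ^ 's" and w :: "nat \<Rightarrow> real"
    and p :: "nat \<Rightarrow> real ^ 's \<Rightarrow> real" and \<eta> V :: real and SF :: "real ^ 's \<Rightarrow> complex"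
  assumes region: "bounded_region \<Omega>"
    and measure: "finite_measure_on \<Omega> M"
    and mass: "V = measure M \<Omega>"
    and K: "K \<in> Lp_space 1 M \<inter> Lp_space 2 M" "continuous_on \<Omega> K"
    and f: "continuous_on \<Omega> f"
    and F: "\<And>x. x \<in> \<Omega> \<Longrightarrow> F x = K x * f x"
    and scalars: "\<F> = scalars \<Omega> K f"
    and degrees: "0 < n'" "n' \<le> n"
    and basis: "real_orthonormal_basis \<Omega> M \<F> n d p"
    and quadrature: "positive_quadrature \<Omega> m xs w"
    and exact: "exactness_degree \<Omega> M \<F> m xs w (n + n')"
    and MZ: "MZ_property \<Omega> M \<F> m xs w n n' \<eta>"
    and SF: "SF = efficient_hyperinterpolant M m xs w d p K f"
  shows "Lp_norm 2 M SF \<le> sqrt V / sqrt (1 - \<eta>) * sup_norm \<Omega> K * sup_norm \<Omega> f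
    \<and> (\<forall>q. best_uniform_approximation \<Omega> \<F> n' f q \<longrightarrow>
        Lp_norm 2 M (\<lambda>x. SF x - F x) \<le>
          (sqrt V / sqrt (1 - \<eta>) * sup_norm \<Omega> K + Lp_norm 2 M K) * best_error \<Omega> \<F> n' f
          + 2 * sqrt V * best_error \<Omega> \<F> n (\<lambda>x. K x * q x))"
proof -
  have compact: "compact \<Omega>" and nonempty: "\<Omega> \<noteq> {}"
    using region compact_bounded_region by (auto simp: bounded_region_def)
  interpret scalar_ring \<F>
    unfolding scalars by (rule scalar_ring_scalars)
  interpret finite_measure M
    using measure by (simp add: finite_measure_on_def)
  interpret hyperinterpolation \<Omega> M \<F> n n' m d xs w p \<eta>
    by unfold_locales (fact measure compact nonempty degrees basis quadrature exact MZ)+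
  have F_eq: "Lp_norm 2 M (\<lambda>x. g x - F x) = Lp_norm 2 M (\<lambda>x. g x - K x * f x)" for g
    by (intro Lp_norm_cong) (simp add: space_eq F)
  show ?thesis
  proof (intro conjI allI impI)
    show "Lp_norm 2 M SF \<le> sqrt V / sqrt (1 - \<eta>) * sup_norm \<Omega> K * sup_norm \<Omega> f"
      unfolding SF mass by (intro efficient_hyperinterpolant_norm_le K f)
  next
    fix q assume "best_uniform_approximation \<Omega> \<F> n' f q"
    then have q: "q \<in> polys \<Omega> \<F> n'" and best: "sup_norm \<Omega> (\<lambda>x. f x - q x) = best_error \<Omega> \<F> n' f"
      by (auto simp: best_uniform_approximation_def)
    \<comment> \<open>The error estimate holds with factor \<open>1\<close> in front of this term;
      its nonnegativity gives the stated factor \<open>2\<close>.\<close>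
    have "0 \<le> best_error \<Omega> \<F> n (\<lambda>x. K x * q x)"
      using polys_const[OF zero_closed, of \<Omega> n]
      by (intro best_error_nonneg compact nonempty continuous_on_mult K continuous_on_polys[OF q]) auto
    then have "0 \<le> sqrt V * best_error \<Omega> \<F> n (\<lambda>x. K x * q x)"
      by (simp add: mass)
    then show "Lp_norm 2 M (\<lambda>x. SF x - F x) \<le>
        (sqrt V / sqrt (1 - \<eta>) * sup_norm \<Omega> K + Lp_norm 2 M K) * best_error \<Omega> \<F> n' f
        + 2 * sqrt V * best_error \<Omega> \<F> n (\<lambda>x. K x * q x)"
      using efficient_hyperinterpolant_error_le[OF K(2) f q]
      unfolding F_eq SF mass best by linarith
  qed
qed

end
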